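(* Let $r\ge1$, $\delta\ge3$ be integers and $n_L=r+\delta-1$. Suppose there exists an $((n_L,r,d),(\alpha,\beta))$ exact-repair MSR code over $\mathbb{F}_q$. Then there exists an $[n,K,d_{\min},\alpha]$ MSR-local code $\mathcal{C}$ over $\mathbb{F}_q$ with $(r,\delta)$ all-symbol locality such that $$d_{\min}=n-\frac{K}{\alpha}+1-\left(\left\lceil\frac{K}{r\alpha}\right\rceil-1\right)(\delta-1),$$ whenever - $K=\ell\alpha$ for some positive integer $\ell\ge r$, - $n=mn_L$ for some positive integer $m\ge\frac{\ell}{r}$, and - the field size satisfies $q>\binom{n}{\ell}$.
   Context: Vector codes. An $\mathbb{F}_q$-linear vector code $\mathcal{C}$ of block length $n$ with vector-size parameter $\alpha$ is an $\mathbb{F}_q$-linear subspace of $(\mathbb{F}_q^\alpha)^n$; its scalar dimension is $K=\dim_{\mathbb{F}_q}\mathcal{C}$. Its generator matrix $G$ is a $K\times n\alpha$ generator matrix of the scalar code obtained by expanding each vector symbol; columns $(i-1)\alpha+1,\dots,i\alpha$ form the $i$-th thick column, associated with the $i$-th vector symbol. Standing assumption: the $\alpha$ columns in each thick column are linearly independent. For $S\subseteq[n]$, $G|_S$ is the restriction to thick columns in $S$, and $\mathcal{C}|_S$ the punctured code (restriction of codewords to $S$). $d_{\min}$ is the minimum Hamming weight, counted in vector symbols, of a nonzero codeword. $[n,K,d_{\min},\alpha]$ lists block length, scalar dimension, minimum distance and vector-size parameter. MSR codes. A linear exact-repair $((n,k,d),(\alpha,\beta),B)$ regenerating code over $\mathbb{F}_q$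 ($k\le d\le n-1$) is a vector code of block length $n$, vector-size parameter $\alpha$ and scalar dimension $B$ such that (i) every codeword is determined by any $k$ of its vector symbols; (ii) for every $i\in[n]$ and every set $D\subseteq[n]\setminus\{i\}$ with $|D|=d$ there are $\mathbb{F}_q$-linear maps $\varphi_h:\mathbb{F}_q^\alpha\to\mathbb{F}_q^\beta$, $h\in D$, such that for every codeword $\mathbf{c}$ the symbol $\mathbf{c}_i$ is determined by $(\varphi_h(\mathbf{c}_h))_{h\in D}$. It is an MSR code if $B=k\alpha$ and $\alpha=(d-k+1)\beta$. An MSR code with parameters $(n,k,d)$ is called an $(n,k,d)$-MSR code. Locality. $\mathcal{C}$ has $(r,\delta)$ information locality if there are sets $S_i\subseteq[n]$, $i\in\mathcal{L}$, with $|S_i|\le r+\delta-1$, $d_{\min}(\mathcal{C}|_{S_i})\ge\delta$, and $\mathrm{Rank}(G|_{\cup_iS_i})=K$. $\mathcal{C}$ is an MSR-local code with $(r,\delta)$ all-symbol locality if it has $(r,\delta)$ information locality and can be punctured to yield local codes $\mathcal{C}_i=\mathcal{C}|_{S_i}$, $i=1,\dots,m$, each an $(n_L,r,d)$-MSR code with $n_L=r+\delta-1$, such that $\mathrm{Rank}(G|_{\cup_{i=1}^mS_i})=K$ and $\cup_{i=1}^mS_i=[n]$. *)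

theory Defs
  imports Complex_Main "HOL-Library.Function_Algebras" "HOL-Library.Cardinality"
begin

text \<open>
  Vectors over a field are functions from an index type to the field. The coordinate space
  \<open>F^X\<close> over an index set \<open>X\<close> is represented by the functions vanishing outside \<open>X\<close>,
  so that the library theory of vector spaces applies to subspaces of a fixed type.
\<close>

definition fscale :: "'a::field \<Rightarrow> ('i \<Rightarrow> 'a) \<Rightarrow> ('i \<Rightarrow> 'a)" where
  "fscale a f = (\<lambda>x. a * f x)"

global_interpretation fs: vector_space "fscale :: 'a::field \<Rightarrow> ('i \<Rightarrow> 'a) \<Rightarrow> ('i \<Rightarrow> 'a)"
  by unfold_locales (auto simp: fscale_def fun_eq_iff algebra_simps)

definition coord_space :: "'i set \<Rightarrow> ('i \<Rightarrow> 'a::field) set" where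
  "coord_space X = {f. \<forall>x. x \<notin> X \<longrightarrow> f x = 0}"

text \<open>
  A word of a vector code is stored through its scalar expansion: \<open>c (i, j)\<close> is the \<open>j\<close>-th scalar
  of the \<open>i\<close>-th vector symbol. The vector symbols are labelled by an arbitrary finite set \<open>I\<close>
  (\<open>{1..n}\<close> for a code of block length \<open>n\<close>), so that a punctured code keeps the labels
  of the surviving symbols; its block length is \<open>card I\<close>.
\<close>

type_synonym 'a word = "nat \<times> nat \<Rightarrow> 'a"

definition symb :: "'a word \<Rightarrow> nat \<Rightarrow> (nat \<Rightarrow> 'a)" where
  "symb c i = (\<lambda>j. c (i, j))"

text \<open>
  A matrix with rows \<open>1, \<dots>, K\<close> is given by its sequence of rows. Its column \<open>(i, j)\<close> is the
  \<open>j\<close>-th column of the \<open>i\<close>-th thick column.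
\<close>

definition generator_matrix :: "nat \<Rightarrow> 'a::field word set \<Rightarrow> (nat \<Rightarrow> 'a word) \<Rightarrow> bool" where
  "generator_matrix K C G \<longleftrightarrow>
     inj_on G {1..K} \<and> fs.independent (G ` {1..K}) \<and> fs.span (G ` {1..K}) = C"

definition gcol :: "nat \<Rightarrow> (nat \<Rightarrow> 'a::field word) \<Rightarrow> nat \<times> nat \<Rightarrow> (nat \<Rightarrow> 'a)" where
  "gcol K G p = (\<lambda>l. if l \<in> {1..K} then G l p else 0)"

definition thick_rank :: "nat \<Rightarrow> nat \<Rightarrow> (nat \<Rightarrow> 'a::field word) \<Rightarrow> nat set \<Rightarrow> nat" where
  "thick_rank K \<alpha> G S = fs.dim (gcol K G ` (S \<times> {1..\<alpha>}))"

definition vector_code :: "nat set \<Rightarrow> nat \<Rightarrow> nat \<Rightarrow> 'a::field word set \<Rightarrow> bool" where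
  "vector_code I K \<alpha> C \<longleftrightarrow>
     finite I \<and> 0 < \<alpha> \<and>
     C \<subseteq> coord_space (I \<times> {1..\<alpha>}) \<and> fs.subspace C \<and> fs.dim C = K \<and>
     (\<exists>G. generator_matrix K C G \<and>
        (\<forall>i\<in>I. inj_on (gcol K G) ({i} \<times> {1..\<alpha>}) \<and>
                fs.independent (gcol K G ` ({i} \<times> {1..\<alpha>}))))"

definition weight :: "'a::field word \<Rightarrow> nat" where
  "weight c = card {i. symb c i \<noteq> 0}"

text \<open>For the zero code the set below is empty and the value is the dummy \<open>0\<close>.\<close>

definition d_min :: "'a::field word set \<Rightarrow> nat" where
  "d_min C = Inf {weight c | c. c \<in> C \<and> c \<noteq> 0}"

definition restrict_word :: "nat set \<Rightarrow> 'a::field word \<Rightarrow> 'a word" where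
  "restrict_word S c = (\<lambda>(i, j). if i \<in> S then c (i, j) else 0)"

definition punctured :: "'a::field word set \<Rightarrow> nat set \<Rightarrow> 'a word set" where
  "punctured C S = restrict_word S ` C"

text \<open>
  The repair maps are linear on all of \<open>nat \<Rightarrow> 'a\<close>; only their values on \<open>F^\<alpha>\<close> matter, and every
  linear map \<open>F^\<alpha> \<rightarrow> F^\<beta>\<close> extends to such a map.
\<close>

definition regenerating_code ::
  "nat set \<Rightarrow> nat \<Rightarrow> nat \<Rightarrow> nat \<Rightarrow> nat \<Rightarrow> nat \<Rightarrow> 'a::field word set \<Rightarrow> bool" where
  "regenerating_code I k d \<alpha> \<beta> B C \<longleftrightarrow>
     k \<le> d \<and> d < card I \<and> vector_code I B \<alpha> C \<and>
     (\<forall>T. T \<subseteq> I \<and> card T = k \<longrightarrow>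
        (\<forall>c\<in>C. \<forall>c'\<in>C. (\<forall>i\<in>T. symb c i = symb c' i) \<longrightarrow> c = c')) \<and>
     (\<forall>i\<in>I. \<forall>D. D \<subseteq> I - {i} \<and> card D = d \<longrightarrow>
        (\<exists>\<phi> :: nat \<Rightarrow> (nat \<Rightarrow> 'a) \<Rightarrow> (nat \<Rightarrow> 'a).
           (\<forall>h\<in>D. Vector_Spaces.linear fscale fscale (\<phi> h) \<and>
                   \<phi> h ` coord_space {1..\<alpha>} \<subseteq> coord_space {1..\<beta>}) \<and>
           (\<forall>c\<in>C. \<forall>c'\<in>C.
              (\<forall>h\<in>D. \<phi> h (symb c h) = \<phi> h (symb c' h)) \<longrightarrow> symb c i = symb c' i)))"

definition msr_code ::
  "nat set \<Rightarrow> nat \<Rightarrow> nat \<Rightarrow> nat \<Rightarrow> nat \<Rightarrow> 'a::field word set \<Rightarrow> bool" where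
  "msr_code I k d \<alpha> \<beta> C \<longleftrightarrow>
     regenerating_code I k d \<alpha> \<beta> (k * \<alpha>) C \<and> \<alpha> = (d - k + 1) * \<beta>"

definition information_locality ::
  "nat set \<Rightarrow> nat \<Rightarrow> nat \<Rightarrow> nat \<Rightarrow> nat \<Rightarrow> 'a::field word set \<Rightarrow> bool" where
  "information_locality I K \<alpha> r \<delta> C \<longleftrightarrow>
     (\<exists>G. generator_matrix K C G \<and>
       (\<exists>(L :: nat set) (S :: nat \<Rightarrow> nat set).
          (\<forall>i\<in>L. S i \<subseteq> I \<and> card (S i) \<le> r + \<delta> - 1 \<and> \<delta> \<le> d_min (punctured C (S i))) \<and>
          thick_rank K \<alpha> G (\<Union>i\<in>L. S i) = K))"

definition msr_local_all_symbol ::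
  "nat set \<Rightarrow> nat \<Rightarrow> nat \<Rightarrow> nat \<Rightarrow> nat \<Rightarrow> nat \<Rightarrow> 'a::field word set \<Rightarrow> bool" where
  "msr_local_all_symbol I K \<alpha> r \<delta> d C \<longleftrightarrow>
     vector_code I K \<alpha> C \<and>
     information_locality I K \<alpha> r \<delta> C \<and>
     (\<exists>G. generator_matrix K C G \<and>
       (\<exists>(m :: nat) (S :: nat \<Rightarrow> nat set).
          (\<forall>i\<in>{1..m}. S i \<subseteq> I \<and> card (S i) = r + \<delta> - 1 \<and>
                       (\<exists>\<beta>. msr_code (S i) r d \<alpha> \<beta> (punctured C (S i)))) \<and>
          thick_rank K \<alpha> G (\<Union>i\<in>{1..m}. S i) = K \<and>
          (\<Union>i\<in>{1..m}. S i) = I))"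

end

theory Submission
  imports Defs "HOL-Library.Disjoint_Sets"
begin

text \<open>
  Let \<open>V\<close> be the direct sum of \<open>m\<close> copies of the given MSR code. Any \<open>l\<close> symbols, at most \<open>r\<close> in each
  copy, can be prescribed freely in \<open>V\<close>, because any \<open>r\<close> symbols of an MSR code with \<open>B = r \<alpha>\<close>
  form an information set; so the words of \<open>V\<close> vanishing on such a set have codimension \<open>l \<alpha>\<close>.
  There are at most \<open>n choose l < q\<close> of these subspaces, so they have a common complement \<open>C\<close> in \<open>V\<close>,
  and every such set of symbols is an information set of \<open>C\<close>. Since \<open>r \<le> l\<close>, puncturing \<open>C\<close> to a block
  gives back the full MSR code. A nonzero word of \<open>C\<close> vanishes on no such set, which bounds
  the number of its zeros by \<open>(l - 1) + ((l - 1) div r) (\<delta> - 1)\<close>, and a dimension count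
  shows that this bound is attained.
\<close>

section \<open>Linear algebra over a finite field by counting\<close>

lemma card_field_ge_2: "2 \<le> CARD('a::{field,finite})"
proof -
  have "card {0::'a, 1} \<le> CARD('a)"
    by (rule card_mono) auto
  then show ?thesis by simp
qed

lemma subspace_coord_space: "fs.subspace (coord_space X :: ('i \<Rightarrow> 'a::field) set)"
  by (auto simp: fs.subspace_def coord_space_def fscale_def)

text \<open>The elements of the new span are x + k v with x in \<open>W\<close>, and the pair (k, x)
  is unique: two different values of k would put a nonzero multiple of v, hence v itself, into
  \<open>W\<close>.\<close>

lemma card_span_insert:
  fixes W :: "('i \<Rightarrow> 'a::{field,finite}) set"
  assumes W: "fs.subspace W" "finite W" and v: "v \<notin> W"
  shows "finite (fs.span (insert v W))"
    and "card (fs.span (insert v W)) = CARD('a) * card W"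
proof -
  let ?f = "\<lambda>(k :: 'a, x). x + fscale k v"
  have sW: "fs.span W = W"
    using W by (simp add: fs.span_eq_iff)
  have "inj_on ?f (UNIV \<times> W)"
  proof (rule inj_onI, clarify)
    fix k k' x x'
    assume x: "x \<in> W" "x' \<in> W" and eq: "x + fscale k v = x' + fscale k' v"
    have "fscale (k - k') v = x' - x"
      using eq by (simp add: fs.scale_left_diff_distrib algebra_simps)
    then have mem: "fscale (k - k') v \<in> W"
      using W x by (simp add: fs.subspace_diff)
    have "k = k'"
    proof (rule ccontr)
      assume "k \<noteq> k'"
      then have "v = fscale (inverse (k - k')) (fscale (k - k') v)"
        by simp
      then show False
        using v fs.subspace_scale[OF W(1) mem, of "inverse (k - k')"] by simp
    qed
    then show "k = k' \<and> x = x'" using eq by simp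
  qed
  moreover have "?f ` (UNIV \<times> W) = fs.span (insert v W)"
  proof
    show "?f ` (UNIV \<times> W) \<subseteq> fs.span (insert v W)"
      by (auto intro!: fs.span_add fs.span_scale intro: fs.span_base)
    show "fs.span (insert v W) \<subseteq> ?f ` (UNIV \<times> W)"
    proof
      fix y assume "y \<in> fs.span (insert v W)"
      then obtain k where "y - fscale k v \<in> W"
        by (auto simp: fs.span_insert sW)
      moreover have "y = ?f (k, y - fscale k v)" by simp
      ultimately show "y \<in> ?f ` (UNIV \<times> W)" by blast
    qed
  qed
  ultimately have b: "bij_betw ?f (UNIV \<times> W) (fs.span (insert v W))"
    by (simp add: bij_betw_def)
  from bij_betw_finite[OF b] W show "finite (fs.span (insert v W))"
    by simp
  from bij_betw_same_card[OF b] show "card (fs.span (insert v W)) = CARD('a) * card W"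
    by (simp add: card_cartesian_product)
qed

lemma card_span_independent:
  fixes B :: "('i \<Rightarrow> 'a::{field,finite}) set"
  assumes "finite B" "fs.independent B"
  shows "finite (fs.span B) \<and> card (fs.span B) = CARD('a) ^ card B"
  using assms
proof (induction B)
  case empty
  then show ?case by simp
next
  case (insert b B)
  then have B: "b \<notin> fs.span B" "fs.independent B"
    by (auto simp: fs.independent_insert)
  have "fs.span (insert b B) = fs.span (insert b (fs.span B))"
    by (simp add: fs.span_insert[of _ B] fs.span_insert[of _ "fs.span B"] fs.span_span)
  then show ?case
    using card_span_insert[of "fs.span B" b] insert B by simp
qed

lemma card_subspace_eq_dim:
  fixes V :: "('i \<Rightarrow> 'a::{field,finite}) set"
  assumes V: "fs.subspace V" "finite V"
  shows "card V = CARD('a) ^ fs.dim V"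
proof -
  obtain B where B: "B \<subseteq> V" "fs.independent B" "V \<subseteq> fs.span B" "card B = fs.dim V"
    by (rule fs.basis_exists)
  have "fs.span B = V"
    by (rule subset_antisym[OF fs.span_minimal[OF B(1) V(1)] B(3)])
  moreover have "finite B"
    by (rule finite_subset[OF B(1) V(2)])
  ultimately show ?thesis
    using card_span_independent[of B] B by simp
qed

text \<open>Dimensions are computed by counting: the exponent of a power of \<open>CARD('a)\<close>
  is unique because the base is at least 2.\<close>

lemma dim_eq_if_card:
  fixes V :: "('i \<Rightarrow> 'a::{field,finite}) set"
  assumes "fs.subspace V" "finite V" "card V = CARD('a) ^ K"
  shows "fs.dim V = K"
  using card_subspace_eq_dim[OF assms(1,2)] assms(3) card_field_ge_2[where 'a='a]
  by simp

lemma card_coord_space: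
  fixes P :: "'i set"
  assumes "finite P"
  shows "finite (coord_space P :: ('i \<Rightarrow> 'a::{field,finite}) set) \<and>
    card (coord_space P :: ('i \<Rightarrow> 'a) set) = CARD('a) ^ card P"
  using assms
proof (induction P)
  case empty
  have "coord_space {} = {0 :: 'i \<Rightarrow> 'a}"
    by (auto simp: coord_space_def fun_eq_iff)
  then show ?case by simp
next
  case (insert p P)
  let ?V = "coord_space P :: ('i \<Rightarrow> 'a) set"
  let ?e = "(\<lambda>x. if x = p then 1 else 0) :: 'i \<Rightarrow> 'a"
  have sub: "fs.subspace ?V" by (rule subspace_coord_space)
  have e: "?e \<notin> ?V"
    using insert by (auto simp: coord_space_def)
  have "fs.span (insert ?e ?V) = coord_space (insert p P)"
  proof -
    have "(\<exists>k. y - fscale k ?e \<in> ?V) \<longleftrightarrow> y \<in> coord_space (insert p P)" for y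
    proof
      assume "\<exists>k. y - fscale k ?e \<in> ?V"
      then show "y \<in> coord_space (insert p P)"
        by (auto simp: coord_space_def fscale_def)
    next
      assume "y \<in> coord_space (insert p P)"
      \<comment> \<open>Subtracting this multiple of the unit vector clears exactly the coordinate
        \<open>p\<close>.\<close>
      then have "y - fscale (y p) ?e \<in> ?V"
        by (auto simp: coord_space_def fscale_def)
      then show "\<exists>k. y - fscale k ?e \<in> ?V" ..
    qed
    then show ?thesis
      using sub by (simp add: fs.span_insert fs.span_eq_iff[THEN iffD2])
  qed
  then show ?case
    using card_span_insert[OF sub _ e] insert by simp
qed

lemma finite_subset_coord_space:
  assumes "finite P" "C \<subseteq> (coord_space P :: ('i \<Rightarrow> 'a::{field,finite}) set)"
  shows "finite C"
  using card_coord_space[OF assms(1), where 'a='a] by (intro finite_subset[OF assms(2)]) simp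

text \<open>Greedy choice: fewer than \<open>q\<close> subspaces of positive codimension do not cover \<open>V\<close>, so one
  vector can be adjoined to all of them, which lowers the codimension by one.\<close>

lemma common_complement:
  fixes V :: "('i \<Rightarrow> 'a::{field,finite}) set"
  assumes "fs.subspace V" "finite V" "finite \<W>" "\<W> \<noteq> {}" "card \<W> < CARD('a)"
    and "\<And>W. W \<in> \<W> \<Longrightarrow> fs.subspace W \<and> W \<subseteq> V \<and> card V = card W * CARD('a) ^ K"
  shows "\<exists>C. fs.subspace C \<and> C \<subseteq> V \<and> card C = CARD('a) ^ K \<and> (\<forall>W\<in>\<W>. C \<inter> W = {0})"
  using assms(3-6)
proof (induction K arbitrary: \<W>)
  case 0
  have "0 \<in> V" using assms(1) by (simp add: fs.subspace_0)
  moreover have "\<forall>W\<in>\<W>. 0 \<in> W"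
    using 0 by (auto simp: fs.subspace_0)
  ultimately show ?case
    by (intro exI[of _ "{0}"]) (auto simp: fs.subspace_single_0)
next
  case (Suc K)
  let ?q = "CARD('a)"
  have fin: "finite W" if "W \<in> \<W>" for W
    using Suc.prems(4)[OF that] assms(2) by (auto intro: finite_subset)
  have posV: "0 < card V"
    using fs.subspace_0[OF assms(1)] assms(2) by (auto simp: card_gt_0_iff)
  \<comment> \<open>With q the field size, all members have the same size |V| / q^(K+1), so fewer
    than q of them cover fewer than |V| / q^K elements.\<close>
  have "card (\<Union>\<W>) < card V"
  proof -
    obtain W0 where W0: "W0 \<in> \<W>" using Suc.prems by blast
    have "card W = card W0" if "W \<in> \<W>" for W
      using Suc.prems(4)[OF that] Suc.prems(4)[OF W0] by simp
    then have "card (\<Union>\<W>) \<le> card \<W> * card W0"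
      using card_Union_le_sum_card[of \<W>] by simp
    also have "\<dots> < ?q * card W0"
      using Suc.prems posV Suc.prems(4)[OF W0] by (intro mult_strict_right_mono) auto
    also have "\<dots> \<le> ?q * card W0 * ?q ^ K"
      by simp
    also have "\<dots> = card V"
      using Suc.prems(4)[OF W0] by simp
    finally show ?thesis .
  qed
  moreover have "\<Union>\<W> \<subseteq> V" using Suc.prems by blast
  ultimately have "\<Union>\<W> \<subset> V" by auto
  then obtain v where v: "v \<in> V" "v \<notin> \<Union>\<W>" by blast
  \<comment> \<open>Adjoining \<open>v\<close> multiplies the size of each member by q, so the
    codimension drops from \<open>Suc K\<close> to \<open>K\<close>, and the new family is no larger
    than \<open>\<W>\<close>.\<close>
  define \<W>' where "\<W>' = (\<lambda>W. fs.span (insert v W)) ` \<W>"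
  have "\<exists>C. fs.subspace C \<and> C \<subseteq> V \<and> card C = ?q ^ K \<and> (\<forall>W\<in>\<W>'. C \<inter> W = {0})"
  proof (rule Suc.IH)
    show "finite \<W>'" "\<W>' \<noteq> {}" using Suc.prems by (auto simp: \<W>'_def)
    show "card \<W>' < ?q"
      using card_image_le[OF Suc.prems(1)] Suc.prems(3) unfolding \<W>'_def
      by (rule le_less_trans)
    fix W' assume "W' \<in> \<W>'"
    then obtain W where W: "W \<in> \<W>" "W' = fs.span (insert v W)"
      by (auto simp: \<W>'_def)
    note p = Suc.prems(4)[OF W(1)]
    have "card W' = ?q * card W"
      using card_span_insert(2)[of W v] p W v fin by auto
    moreover have "W' \<subseteq> V"
      unfolding W(2) using p v assms(1) by (intro fs.span_minimal) auto
    ultimately show "fs.subspace W' \<and> W' \<subseteq> V \<and> card V = card W' * ?q ^ K"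
      using p W by simp
  qed
  then obtain C where C: "fs.subspace C" "C \<subseteq> V" "card C = ?q ^ K"
    "\<And>W. W \<in> \<W>' \<Longrightarrow> C \<inter> W = {0}" by blast
  have sC: "fs.span C = C" using C by (simp add: fs.span_eq_iff)
  have finC: "finite C" by (rule finite_subset[OF C(2) assms(2)])
  have disj: "x = 0" if "x \<in> C" "x \<in> fs.span (insert v W)" "W \<in> \<W>" for x W
    using C(4)[of "fs.span (insert v W)"] that by (auto simp: \<W>'_def)
  \<comment> \<open>Otherwise \<open>v\<close> lies in \<open>C\<close> and in an enlarged member,
    so it is 0; but 0 belongs to every member of \<open>\<W>\<close>, against the choice of
    \<open>v\<close>.\<close>
  have vC: "v \<notin> C"
  proof
    assume "v \<in> C"
    moreover obtain W where W: "W \<in> \<W>" using Suc.prems by blast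
    ultimately have "v = 0"
      using disj[of v W] by (simp add: fs.span_base)
    then show False
      using v(2) W fs.subspace_0[of W] Suc.prems(4)[OF W] by auto
  qed
  show ?case
  proof (intro exI conjI ballI)
    show "fs.subspace (fs.span (insert v C))" by simp
    show "fs.span (insert v C) \<subseteq> V"
      using C v assms(1) by (intro fs.span_minimal) auto
    show "card (fs.span (insert v C)) = ?q ^ Suc K"
      using card_span_insert(2)[OF C(1) finC vC] C by simp
    fix W assume W: "W \<in> \<W>"
    have sW: "fs.subspace W" using Suc.prems(4)[OF W] by simp
    \<comment> \<open>The vector \<open>x - fscale k v\<close> lies in \<open>C\<close> and in the
      enlargement of \<open>W\<close>, so it is 0. Then x is a multiple of \<open>v\<close> inside
      \<open>W\<close>, which forces k = 0.\<close>
    have "x = 0" if x: "x \<in> fs.span (insert v C)" "x \<in> W" for x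
    proof -
      obtain k where k: "x - fscale k v \<in> C"
        using x by (auto simp: fs.span_insert sC)
      have "x - fscale k v \<in> fs.span (insert v W)"
        by (intro fs.span_diff fs.span_scale fs.span_base) (use x in auto)
      from disj[OF k this W] have xk: "x = fscale k v" by simp
      have "k = 0"
      proof (rule ccontr)
        assume "k \<noteq> 0"
        then have "v = fscale (inverse k) x" by (simp add: xk)
        then have "v \<in> W" using fs.subspace_scale[OF sW x(2), of "inverse k"] by simp
        then show False using v W by blast
      qed
      then show ?thesis using xk by simp
    qed
    moreover have "0 \<in> W" "0 \<in> fs.span (insert v C)"
      using sW by (auto simp: fs.subspace_0 fs.span_zero)
    ultimately show "fs.span (insert v C) \<inter> W = {0}" by blast
  qed
qed

section \<open>Words, restrictions and generator matrices\<close>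

lemma restrict_word_apply: "restrict_word S c p = (if fst p \<in> S then c p else 0)"
  by (cases p) (simp add: restrict_word_def)

lemma restrict_word_linear:
  "restrict_word S (x + y) = restrict_word S x + restrict_word S y"
  "restrict_word S (x - y) = restrict_word S x - restrict_word S y"
  "restrict_word S (fscale a x) = fscale a (restrict_word S x)"
  "restrict_word S 0 = 0"
  by (auto simp: restrict_word_apply fun_eq_iff fscale_def)

lemma restrict_word_restrict_word:
  "restrict_word S (restrict_word T c) = restrict_word (S \<inter> T) c"
  by (auto simp: restrict_word_apply fun_eq_iff)

lemma restrict_word_eq_iff:
  "restrict_word T c = restrict_word T c' \<longleftrightarrow> (\<forall>i\<in>T. symb c i = symb c' i)"
  by (auto simp: restrict_word_apply fun_eq_iff symb_def)

lemma restrict_word_eq_0_iff: "restrict_word T c = 0 \<longleftrightarrow> (\<forall>i\<in>T. symb c i = 0)"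
  by (auto simp: restrict_word_apply fun_eq_iff symb_def)

lemma coord_space_outside: "c \<in> coord_space (I \<times> A) \<Longrightarrow> fst p \<notin> I \<Longrightarrow> c p = 0"
  by (cases p) (simp add: coord_space_def)

lemma restrict_word_coord_space:
  "c \<in> coord_space (I \<times> A) \<Longrightarrow> restrict_word S c \<in> coord_space ((S \<inter> I) \<times> A)"
  by (auto simp: restrict_word_apply coord_space_def)

text \<open>Injectivity says that the symbols in \<open>T\<close> determine the codeword,
  surjectivity that they can be prescribed freely; both halves are used below.\<close>

definition information_set :: "nat \<Rightarrow> 'a::field word set \<Rightarrow> nat set \<Rightarrow> bool" where
  "information_set \<alpha> C T \<longleftrightarrow> bij_betw (restrict_word T) C (coord_space (T \<times> {1..\<alpha>}))"

text \<open>An injection between finite sets of equal size is onto, so unique recovery from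
  \<open>T\<close> already gives free prescription on \<open>T\<close>.\<close>

lemma information_setI:
  fixes C :: "'a::{field,finite} word set"
  assumes "C \<subseteq> coord_space (I \<times> {1..\<alpha>})" "T \<subseteq> I" "finite T"
    and card: "card C = CARD('a) ^ (card T * \<alpha>)"
    and inj: "inj_on (restrict_word T) C"
  shows "information_set \<alpha> C T"
proof -
  let ?X = "coord_space (T \<times> {1..\<alpha>}) :: 'a word set"
  have X: "finite ?X" "card ?X = card C"
    using card_coord_space[of "T \<times> {1..\<alpha>}", where 'a='a] assms by auto
  have "restrict_word T c \<in> ?X" if "c \<in> C" for c
    using restrict_word_coord_space[of c I "{1..\<alpha>}" T] assms that
    by (auto simp: Int_absorb2)
  then have "restrict_word T ` C \<subseteq> ?X" by blast
  moreover have "card (restrict_word T ` C) = card ?X"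
    using inj X by (simp add: card_image)
  ultimately have "restrict_word T ` C = ?X"
    using X by (simp add: card_subset_eq)
  then show ?thesis
    using inj by (simp add: information_set_def bij_betw_def)
qed

text \<open>A word supported on a part \<open>R\<close> of \<open>T\<close> is an admissible
  prescription on \<open>T\<close>: it asks for zeros on the rest.\<close>

lemma information_set_surj:
  assumes "information_set \<alpha> C T" "R \<subseteq> T" "f \<in> coord_space (R \<times> {1..\<alpha>})"
  obtains c where "c \<in> C" "restrict_word T c = f"
proof -
  have "f \<in> coord_space (T \<times> {1..\<alpha>})"
    using assms(2,3) by (auto simp: coord_space_def)
  then have "f \<in> restrict_word T ` C"
    using assms(1) by (simp add: information_set_def bij_betw_def)
  then show thesis using that by auto
qed

lemma information_set_inj:
  assumes "information_set \<alpha> C T" "c \<in> C" "c' \<in> C" "restrict_word T c = restrict_word T c'"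
  shows "c = c'"
  using assms by (auto simp: information_set_def bij_betw_def dest: inj_onD)

lemma generator_matrix_exists:
  fixes C :: "'a::{field,finite} word set"
  assumes C: "fs.subspace C" "finite C" and dim: "fs.dim C = K"
  obtains G where "generator_matrix K C G"
proof -
  obtain B where B: "B \<subseteq> C" "fs.independent B" "C \<subseteq> fs.span B" "card B = fs.dim C"
    by (rule fs.basis_exists)
  have "fs.span B = C"
    by (rule subset_antisym[OF fs.span_minimal[OF B(1) C(1)] B(3)])
  have "finite B"
    by (rule finite_subset[OF B(1) C(2)])
  then obtain G where "bij_betw G {1..K} B"
    using bij_betw_iff_card[of "{1..K}" B] B dim by auto
  then have "generator_matrix K C G"
    using B \<open>fs.span B = C\<close> by (simp add: generator_matrix_def bij_betw_def)
  then show thesis by (rule that)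
qed

text \<open>A codeword \<open>c\<close> is a combination \<open>u\<close> of rows, so \<open>c p\<close> is the value of the linear functional
  \<open>u\<close> at column \<open>p\<close>; a codeword that is a unit vector on \<open>P\<close> separates one column from the others.\<close>

lemma columns_independent:
  fixes C :: "'a::field word set"
  assumes G: "generator_matrix K C G"
    and surj: "\<And>f. f \<in> coord_space P \<Longrightarrow> \<exists>c\<in>C. \<forall>p\<in>P. c p = f p"
  shows "inj_on (gcol K G) P \<and> fs.independent (gcol K G ` P)"
proof -
  have notin: "gcol K G p \<notin> fs.span (gcol K G ` (P - {p}))" if p: "p \<in> P" for p
  proof -
    let ?e = "(\<lambda>x. if x = p then 1 else 0) :: 'a word"
    have "?e \<in> coord_space P" using p by (auto simp: coord_space_def)
    then obtain c where c: "c \<in> C" "\<forall>x\<in>P. c x = ?e x" using surj by blast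
    have "c \<in> fs.span (G ` {1..K})" using G c by (simp add: generator_matrix_def)
    then obtain w where w: "c = (\<Sum>v\<in>G ` {1..K}. fscale (w v) v)"
      by (auto simp: fs.span_finite)
    have "c = (\<Sum>k\<in>{1..K}. fscale (w (G k)) (G k))"
      unfolding w using G by (simp add: generator_matrix_def sum.reindex)
    moreover have "(\<Sum>k\<in>X. fscale (w (G k)) (G k)) x = (\<Sum>k\<in>X. w (G k) * G k x)"
      if "finite X" for X x
      using that by induction (auto simp: fscale_def)
    ultimately have cx: "c x = (\<Sum>k\<in>{1..K}. w (G k) * gcol K G x k)" for x
      by (simp add: gcol_def)
    \<comment> \<open>The kernel of the functional contains the columns of \<open>P\<close> other
      than \<open>p\<close> but not column \<open>p\<close>, where its value is 1.\<close>
    let ?N = "{y :: nat \<Rightarrow> 'a. (\<Sum>k\<in>{1..K}. w (G k) * y k) = 0}"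
    have "(\<Sum>k\<in>{1..K}. w (G k) * (a * y k)) = a * (\<Sum>k\<in>{1..K}. w (G k) * y k)"
      for a :: 'a and y
      by (simp add: sum_distrib_left algebra_simps)
    then have "fs.subspace ?N"
      by (auto simp: fs.subspace_def fscale_def distrib_left sum.distrib)
    moreover have "gcol K G ` (P - {p}) \<subseteq> ?N"
      using c cx by auto
    ultimately have "fs.span (gcol K G ` (P - {p})) \<subseteq> ?N"
      by (intro fs.span_minimal)
    moreover have "gcol K G p \<notin> ?N"
      using c cx[of p] p by auto
    ultimately show ?thesis by blast
  qed
  have "inj_on (gcol K G) P"
  proof (rule inj_onI, rule ccontr)
    fix x y assume "x \<in> P" "y \<in> P" "gcol K G x = gcol K G y" "x \<noteq> y"
    then show False
      using notin[of x] by (auto intro!: fs.span_base)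
  qed
  moreover have "fs.independent (gcol K G ` P)"
    unfolding fs.dependent_def
  proof clarify
    fix p assume p: "p \<in> P" "gcol K G p \<in> fs.span (gcol K G ` P - {gcol K G p})"
    have "gcol K G ` P - {gcol K G p} \<subseteq> gcol K G ` (P - {p})" by auto
    from fs.span_mono[OF this] p notin show False by blast
  qed
  ultimately show ?thesis ..
qed

text \<open>If symbol i belongs to an information set, its \<alpha> scalars can be prescribed
  freely, which makes the columns of its thick column independent.\<close>

lemma vector_codeI:
  fixes C :: "'a::{field,finite} word set"
  assumes I: "finite I" "0 < \<alpha>" and C: "C \<subseteq> coord_space (I \<times> {1..\<alpha>})" "fs.subspace C"
    and card: "card C = CARD('a) ^ K"
    and info: "\<And>i. i \<in> I \<Longrightarrow> \<exists>T. i \<in> T \<and> information_set \<alpha> C T"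
  shows "vector_code I K \<alpha> C"
proof -
  have fin: "finite C"
    using C I by (intro finite_subset_coord_space[of "I \<times> {1..\<alpha>}"]) auto
  have dim: "fs.dim C = K" using C fin card by (intro dim_eq_if_card)
  obtain G where G: "generator_matrix K C G"
    using generator_matrix_exists[OF C(2) fin dim] .
  have "inj_on (gcol K G) ({i} \<times> {1..\<alpha>}) \<and> fs.independent (gcol K G ` ({i} \<times> {1..\<alpha>}))"
    if "i \<in> I" for i
  proof (rule columns_independent[OF G])
    fix f :: "'a word" assume f: "f \<in> coord_space ({i} \<times> {1..\<alpha>})"
    obtain T where T: "i \<in> T" "information_set \<alpha> C T"
      using info[OF \<open>i \<in> I\<close>] by (elim exE conjE)
    obtain c where c: "c \<in> C" "restrict_word T c = f"
      using information_set_surj[OF T(2) _ f] T(1) by auto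
    have "\<forall>p\<in>{i} \<times> {1..\<alpha>}. c p = f p"
      unfolding c(2)[symmetric] using T by (auto simp: restrict_word_apply)
    then show "\<exists>c\<in>C. \<forall>p\<in>{i} \<times> {1..\<alpha>}. c p = f p" using c by blast
  qed
  then show ?thesis
    unfolding vector_code_def using I C dim G by (intro conjI exI[of _ G] ballI) simp_all
qed

text \<open>The columns over \<open>T\<close> are \<open>K\<close> independent vectors in a space of
  dimension \<open>K\<close>. They span it, so further columns cannot raise the rank.\<close>

lemma thick_rank_information_set:
  fixes C :: "'a::{field,finite} word set"
  assumes G: "generator_matrix K C G" and T: "information_set \<alpha> C T" "finite T" "card T * \<alpha> = K"
    and "T \<subseteq> S"
  shows "thick_rank K \<alpha> G S = K"
proof -
  let ?P = "T \<times> {1..\<alpha>}"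
  let ?B = "gcol K G ` ?P"
  have B: "inj_on (gcol K G) ?P" "fs.independent ?B"
  proof -
    have "\<exists>c\<in>C. \<forall>p\<in>?P. c p = f p" if f: "f \<in> coord_space ?P" for f
    proof -
      obtain c where c: "c \<in> C" "restrict_word T c = f"
        using information_set_surj[OF T(1) subset_refl f] by blast
      have "\<forall>p\<in>?P. c p = f p"
        unfolding c(2)[symmetric] by (auto simp: restrict_word_apply)
      then show ?thesis using c by blast
    qed
    from columns_independent[OF G this]
    show "inj_on (gcol K G) ?P" "fs.independent ?B" by auto
  qed
  have card: "card ?B = K" "finite ?B"
    using T B by (auto simp: card_image card_cartesian_product)
  let ?X = "coord_space {1..K} :: (nat \<Rightarrow> 'a) set"
  have X: "gcol K G ` Q \<subseteq> ?X" for Q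
    by (auto simp: coord_space_def gcol_def)
  have "fs.span ?B \<subseteq> ?X"
    by (intro fs.span_minimal X subspace_coord_space)
  moreover have "card (fs.span ?B) = card ?X" "finite ?X"
    using card_span_independent[OF card(2) B(2)] card card_coord_space[of "{1..K}", where 'a='a]
    by auto
  ultimately have "fs.span ?B = ?X"
    by (intro card_subset_eq)
  moreover have "fs.span (gcol K G ` (S \<times> {1..\<alpha>})) \<subseteq> ?X"
    by (intro fs.span_minimal X subspace_coord_space)
  moreover have "fs.span ?B \<subseteq> fs.span (gcol K G ` (S \<times> {1..\<alpha>}))"
    using \<open>T \<subseteq> S\<close> by (intro fs.span_mono image_mono) auto
  ultimately have "fs.span ?B = fs.span (gcol K G ` (S \<times> {1..\<alpha>}))" by blast
  from fs.dim_eq_card[OF this B(2)] show ?thesis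
    using card by (simp add: thick_rank_def)
qed

text \<open>The nonzero codeword \<open>c\<close> keeps the set of weights nonempty, which excludes
  the dummy value 0 of \<open>d_min\<close>.\<close>

lemma le_d_minI:
  assumes "c \<in> C" "c \<noteq> 0" "\<And>c. c \<in> C \<Longrightarrow> c \<noteq> 0 \<Longrightarrow> w \<le> weight c"
  shows "w \<le> d_min C"
  unfolding d_min_def using assms by (intro cInf_greatest) auto

lemma d_min_le: "c \<in> C \<Longrightarrow> c \<noteq> 0 \<Longrightarrow> d_min C \<le> weight c"
  unfolding d_min_def by (intro cInf_lower) auto

text \<open>\<open>weight\<close> counts over all labels, but symbols outside \<open>I\<close>
  vanish, so counting zeros inside \<open>I\<close> is enough.\<close>

lemma weight_eq:
  assumes "c \<in> coord_space (I \<times> A)" "finite I"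
  shows "weight c = card I - card {i\<in>I. symb c i = 0}"
proof -
  have "{i. symb c i \<noteq> 0} = I - {i\<in>I. symb c i = 0}"
    using assms by (fastforce simp: coord_space_def symb_def fun_eq_iff)
  then show ?thesis
    using assms by (simp add: weight_def card_Diff_subset)
qed

section \<open>MSR codes\<close>

lemma msr_codeD:
  fixes C :: "'a::{field,finite} word set"
  assumes "msr_code I r d \<alpha> \<beta> C"
  shows "finite I" "0 < \<alpha>" "C \<subseteq> coord_space (I \<times> {1..\<alpha>})" "fs.subspace C" "finite C"
    "card C = CARD('a) ^ (r * \<alpha>)"
proof -
  have v: "vector_code I (r * \<alpha>) \<alpha> C"
    using assms unfolding msr_code_def regenerating_code_def by (elim conjE)
  then show I: "finite I" "0 < \<alpha>" and C: "C \<subseteq> coord_space (I \<times> {1..\<alpha>})" "fs.subspace C"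
    by (auto simp: vector_code_def)
  show fin: "finite C"
    using C I by (intro finite_subset_coord_space[of "I \<times> {1..\<alpha>}"]) auto
  show "card C = CARD('a) ^ (r * \<alpha>)"
    using card_subspace_eq_dim[OF C(2) fin] v by (simp add: vector_code_def)
qed

text \<open>Any r symbols determine the codeword, and they carry r \<alpha> scalars, exactly the
  dimension of an MSR code. This is the MDS property.\<close>

lemma msr_code_information_set:
  fixes C :: "'a::{field,finite} word set"
  assumes C: "msr_code I r d \<alpha> \<beta> C" and T: "T \<subseteq> I" "card T = r"
  shows "information_set \<alpha> C T"
proof (rule information_setI)
  show "inj_on (restrict_word T) C"
    using assms
    by (auto simp: msr_code_def regenerating_code_def restrict_word_eq_iff intro!: inj_onI)
  show "finite T" by (rule finite_subset[OF T(1) msr_codeD(1)[OF C]])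
qed (use msr_codeD[OF C] T in auto)

definition relabel :: "(nat \<Rightarrow> nat) \<Rightarrow> 'a word \<Rightarrow> 'a word" where
  "relabel g c = (\<lambda>(i, j). c (g i, j))"

lemma symb_relabel: "symb (relabel g c) i = symb c (g i)"
  by (simp add: symb_def relabel_def)

text \<open>This provides copies of one MSR code on other sets of labels. The condition on the
  preimage makes the relabelled words vanish outside \<open>J\<close>.\<close>

lemma msr_code_relabel:
  fixes C :: "'a::{field,finite} word set"
  assumes C: "msr_code I r d \<alpha> \<beta> C" and "0 < r"
    and g: "bij_betw g J I" "g -` I = J"
  shows "msr_code J r d \<alpha> \<beta> (relabel g ` C)"
proof -
  let ?E = "relabel g ` C"
  note D = msr_codeD[OF C]
  have reg: "r \<le> d" "d < card I" "\<alpha> = (d - r + 1) * \<beta>"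
    using C by (auto simp: msr_code_def regenerating_code_def)
  have J: "finite J" "card J = card I"
    using bij_betw_finite[OF g(1)] D(1) bij_betw_same_card[OF g(1)] by simp_all
  have sub: "?E \<subseteq> coord_space (J \<times> {1..\<alpha>})"
    using D(3) g(2) by (fastforce simp: coord_space_def relabel_def)
  have rec: "c = c'" if "T \<subseteq> J" "card T = r" "c \<in> C" "c' \<in> C"
    "\<forall>i\<in>T. symb (relabel g c) i = symb (relabel g c') i" for T c c'
  proof -
    have "g ` T \<subseteq> I" "card (g ` T) = r"
      using that g(1) by (auto simp: bij_betw_def card_image inj_on_subset)
    moreover have "\<forall>i\<in>g ` T. symb c i = symb c' i"
      using that by (auto simp: symb_relabel)
    moreover have "\<forall>T. T \<subseteq> I \<and> card T = r \<longrightarrow>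
        (\<forall>c\<in>C. \<forall>c'\<in>C. (\<forall>i\<in>T. symb c i = symb c' i) \<longrightarrow> c = c')"
      using C unfolding msr_code_def regenerating_code_def by (elim conjE)
    ultimately show ?thesis using that(3,4) by blast
  qed
  have "inj_on (relabel g) C"
  proof (rule inj_onI)
    fix c c' assume c: "c \<in> C" "c' \<in> C" "relabel g c = relabel g c'"
    obtain T where "T \<subseteq> J" "card T = r"
      using obtain_subset_with_card_n[of r J] J reg by auto
    then show "c = c'" using rec c by simp
  qed
  then have card: "card ?E = CARD('a) ^ (r * \<alpha>)"
    using D by (simp add: card_image)
  have lin: "relabel g 0 = 0" "relabel g x + relabel g y = relabel g (x + y)"
    "fscale a (relabel g x) = relabel g (fscale a x)" for x y :: "'a word" and a
    by (auto simp: relabel_def fscale_def fun_eq_iff)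
  have ss: "fs.subspace ?E"
    unfolding fs.subspace_def
  proof (intro conjI allI ballI)
    show "0 \<in> ?E" using imageI[OF fs.subspace_0[OF D(4)], of "relabel g"] by (simp only: lin(1))
  qed (use D(4) in \<open>auto simp: lin fs.subspace_add fs.subspace_scale\<close>)
  have info: "information_set \<alpha> ?E T" if T: "T \<subseteq> J" "card T = r" for T
  proof (rule information_setI[OF sub T(1)])
    show "finite T" by (rule finite_subset[OF T(1) J(1)])
    show "inj_on (restrict_word T) ?E"
      using rec[OF T] by (intro inj_onI) (auto simp: restrict_word_eq_iff)
  qed (use card T in simp)
  have vec: "vector_code J (r * \<alpha>) \<alpha> ?E"
  proof (rule vector_codeI[OF J(1) D(2) sub ss card])
    \<comment> \<open>Positivity of \<open>r\<close> allows a set of size \<open>r\<close> through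
      the given label.\<close>
    fix i assume "i \<in> J"
    then have "\<exists>T. {i} \<subseteq> T \<and> T \<subseteq> J \<and> card T = r"
      using J reg \<open>0 < r\<close> by (intro exists_subset_between) auto
    then show "\<exists>T. i \<in> T \<and> information_set \<alpha> ?E T"
      using info by blast
  qed
  have repair: "\<exists>\<phi> :: nat \<Rightarrow> (nat \<Rightarrow> 'a) \<Rightarrow> (nat \<Rightarrow> 'a).
      (\<forall>h\<in>H. Vector_Spaces.linear fscale fscale (\<phi> h) \<and>
         \<phi> h ` coord_space {1..\<alpha>} \<subseteq> coord_space {1..\<beta>}) \<and>
      (\<forall>c\<in>?E. \<forall>c'\<in>?E. (\<forall>h\<in>H. \<phi> h (symb c h) = \<phi> h (symb c' h)) \<longrightarrow> symb c i = symb c' i)"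
    if i: "i \<in> J" and H: "H \<subseteq> J - {i}" "card H = d" for i H
  proof -
    have inj: "inj_on g J" and gJ: "g ` J = I" using g by (auto simp: bij_betw_def)
    have gi: "g i \<in> I" using i gJ by blast
    have gH: "g ` H \<subseteq> I - {g i}"
      using H i inj gJ by (auto dest: inj_onD)
    have card_gH: "card (g ` H) = d"
      using H by (subst card_image) (auto intro: inj_on_subset[OF inj])
    have "\<forall>i\<in>I. \<forall>D. D \<subseteq> I - {i} \<and> card D = d \<longrightarrow>
        (\<exists>\<phi> :: nat \<Rightarrow> (nat \<Rightarrow> 'a) \<Rightarrow> (nat \<Rightarrow> 'a).
           (\<forall>h\<in>D. Vector_Spaces.linear fscale fscale (\<phi> h) \<and>
                   \<phi> h ` coord_space {1..\<alpha>} \<subseteq> coord_space {1..\<beta>}) \<and>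
           (\<forall>c\<in>C. \<forall>c'\<in>C.
              (\<forall>h\<in>D. \<phi> h (symb c h) = \<phi> h (symb c' h)) \<longrightarrow> symb c i = symb c' i))"
      using C unfolding msr_code_def regenerating_code_def by (elim conjE)
    from this[THEN bspec, OF gi, THEN spec, THEN mp, OF conjI[OF gH card_gH]]
    obtain \<phi> :: "nat \<Rightarrow> (nat \<Rightarrow> 'a) \<Rightarrow> (nat \<Rightarrow> 'a)" where
      "(\<forall>h\<in>g ` H. Vector_Spaces.linear fscale fscale (\<phi> h) \<and>
         \<phi> h ` coord_space {1..\<alpha>} \<subseteq> coord_space {1..\<beta>}) \<and>
      (\<forall>c\<in>C. \<forall>c'\<in>C. (\<forall>h\<in>g ` H. \<phi> h (symb c h) = \<phi> h (symb c' h))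
         \<longrightarrow> symb c (g i) = symb c' (g i))" ..
    \<comment> \<open>Helper h plays the role of \<open>g h\<close> in the original code and uses
      its repair map.\<close>
    then show ?thesis
      by (intro exI[of _ "\<lambda>h. \<phi> (g h)"]) (simp only: ball_simps symb_relabel simp_thms)
  qed
  have recover: "\<forall>c\<in>?E. \<forall>c'\<in>?E. (\<forall>i\<in>T. symb c i = symb c' i) \<longrightarrow> c = c'"
    if "T \<subseteq> J" "card T = r" for T
    using rec[OF that] by blast
  have "regenerating_code J r d \<alpha> \<beta> (r * \<alpha>) ?E"
    unfolding regenerating_code_def J(2)
  proof (intro conjI)
    show "vector_code J (r * \<alpha>) \<alpha> ?E" by (rule vec)
    show "\<forall>i\<in>J. \<forall>H. H \<subseteq> J - {i} \<and> card H = d \<longrightarrow>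
        (\<exists>\<phi> :: nat \<Rightarrow> (nat \<Rightarrow> 'a) \<Rightarrow> (nat \<Rightarrow> 'a).
          (\<forall>h\<in>H. Vector_Spaces.linear fscale fscale (\<phi> h) \<and>
             \<phi> h ` coord_space {1..\<alpha>} \<subseteq> coord_space {1..\<beta>}) \<and>
          (\<forall>c\<in>?E. \<forall>c'\<in>?E.
             (\<forall>h\<in>H. \<phi> h (symb c h) = \<phi> h (symb c' h)) \<longrightarrow> symb c i = symb c' i))"
      by (intro ballI allI impI, elim conjE, rule repair)
    show "\<forall>T. T \<subseteq> J \<and> card T = r \<longrightarrow>
        (\<forall>c\<in>?E. \<forall>c'\<in>?E. (\<forall>i\<in>T. symb c i = symb c' i) \<longrightarrow> c = c')"
      by (intro allI impI, elim conjE, rule recover)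
  qed (rule reg)+
  then show ?thesis
    unfolding msr_code_def using reg(3) ..
qed

text \<open>A nonzero codeword cannot vanish on an information set, and every r symbols form one, so
  it has at most r - 1 zeros.\<close>

lemma d_min_msr_code_ge:
  fixes C :: "'a::{field,finite} word set"
  assumes C: "msr_code I r d \<alpha> \<beta> C" and r: "0 < r"
  shows "card I + 1 - r \<le> d_min C"
proof -
  note D = msr_codeD[OF C]
  \<comment> \<open>Positive dimension gives at least two codewords, hence a nonzero one, as
    \<open>le_d_minI\<close> demands.\<close>
  have "0 < r * \<alpha>" using r D(2) by simp
  then have "CARD('a) ^ 1 \<le> CARD('a) ^ (r * \<alpha>)"
    by (intro power_increasing) auto
  then have "2 \<le> card C"
    unfolding D(6) power_one_right by (rule order_trans[OF card_field_ge_2])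
  then have "C \<noteq> {}" "C \<noteq> {0}" by auto
  then obtain c where "c \<in> C" "c \<noteq> 0" by blast
  then show ?thesis
  proof (rule le_d_minI)
    fix c assume c: "c \<in> C" "c \<noteq> 0"
    let ?Z = "{i\<in>I. symb c i = 0}"
    have "card ?Z < r"
    proof (rule ccontr)
      assume "\<not> card ?Z < r"
      then obtain T where T: "T \<subseteq> ?Z" "card T = r"
        using obtain_subset_with_card_n[of r ?Z] by auto
      have "information_set \<alpha> C T"
        using T by (intro msr_code_information_set[OF C]) auto
      moreover have "restrict_word T c = restrict_word T 0"
        using T by (auto simp: restrict_word_eq_0_iff restrict_word_linear)
      ultimately have "c = 0"
        by (rule information_set_inj[OF _ c(1) fs.subspace_0[OF D(4)]])
      then show False using c(2) by contradiction
    qed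
    then show "card I + 1 - r \<le> weight c"
      unfolding weight_eq[OF subsetD[OF D(3) c(1)] D(1)] by arith
  qed
qed

section \<open>Glueing local codes\<close>

text \<open>Rank-nullity in counting form. With \<open>s\<close> an arbitrary choice of preimages,
  each word is uniquely a kernel element plus \<open>s\<close> of its own restriction.\<close>

lemma card_kernel_restrict_word:
  fixes V :: "'a::field word set"
  assumes V: "fs.subspace V" "finite V"
  shows "card V = card {f\<in>V. restrict_word T f = 0} * card (restrict_word T ` V)"
proof -
  let ?N = "{f\<in>V. restrict_word T f = 0}" and ?X = "restrict_word T ` V"
  define s where "s = inv_into V (restrict_word T)"
  have s: "s y \<in> V" "restrict_word T (s y) = y" if "y \<in> ?X" for y
    using that by (auto simp: s_def inv_into_into f_inv_into_f)
  have "bij_betw (\<lambda>(x, y). x + s y) (?N \<times> ?X) V"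
  proof (rule bij_betwI')
    fix p p' assume p: "p \<in> ?N \<times> ?X" "p' \<in> ?N \<times> ?X"
    obtain x y x' y' where xy: "p = (x, y)" "p' = (x', y')" by fastforce
    have "restrict_word T (x + s y) = y" "restrict_word T (x' + s y') = y'"
      using p xy s by (auto simp: restrict_word_linear)
    then show "((\<lambda>(x, y). x + s y) p = (\<lambda>(x, y). x + s y) p') = (p = p')"
      unfolding xy by auto
  next
    fix p assume "p \<in> ?N \<times> ?X"
    then show "(\<lambda>(x, y). x + s y) p \<in> V"
      using s V by (auto intro!: fs.subspace_add)
  next
    fix f assume f: "f \<in> V"
    let ?y = "restrict_word T f"
    have "?y \<in> ?X" using f by simp
    moreover from s[OF this] have "f - s ?y \<in> ?N"
      using V f by (auto simp: restrict_word_linear fs.subspace_diff)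
    ultimately show "\<exists>p\<in>?N \<times> ?X. f = (\<lambda>(x, y). x + s y) p"
      by (intro bexI[of _ "(f - s ?y, ?y)"]) auto
  qed
  from bij_betw_same_card[OF this] show ?thesis
    by (simp add: card_cartesian_product)
qed

section \<open>Disjoint blocks of MSR codes and their direct sum\<close>

locale local_codes =
  fixes S :: "nat \<Rightarrow> nat set" and E :: "nat \<Rightarrow> 'a::{field,finite} word set"
    and r d \<alpha> \<beta> m :: nat
  assumes r_pos: "0 < r" and m_pos: "0 < m"
    and msr: "b < m \<Longrightarrow> msr_code (S b) r d \<alpha> \<beta> (E b)"
    and disj: "disjoint_family_on S {..<m}"
begin

definition "I = (\<Union>b<m. S b)"

text \<open>Because the blocks are disjoint and cover \<open>I\<close>, these conditions describe
  the direct sum of the local codes.\<close>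

definition "V = {f \<in> coord_space (I \<times> {1..\<alpha>}). \<forall>b<m. restrict_word (S b) f \<in> E b}"

text \<open>The bound r per block is forced: r symbols determine the local codeword, so more than r
  in one block could not be prescribed independently.\<close>

definition "admissible l T \<longleftrightarrow> T \<subseteq> I \<and> card T = l \<and> (\<forall>b<m. card (T \<inter> S b) \<le> r)"

lemma finite_S: "b < m \<Longrightarrow> finite (S b)"
  using msr_codeD(1)[OF msr] .

lemma finite_I: "finite I"
  using finite_S by (auto simp: I_def)

lemma S_subset_I: "b < m \<Longrightarrow> S b \<subseteq> I"
  by (auto simp: I_def)

lemma r_le_card: "b < m \<Longrightarrow> r \<le> card (S b)"
  using msr[of b] unfolding msr_code_def regenerating_code_def by linarith

text \<open>A fixed information set of each local code.\<close>

definition "sel b = (SOME R. R \<subseteq> S b \<and> card R = r)"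

lemma sel:
  assumes "b < m"
  shows "sel b \<subseteq> S b" "card (sel b) = r"
proof -
  obtain R where "R \<subseteq> S b" "card R = r"
    using obtain_subset_with_card_n[OF r_le_card[OF assms]] .
  then have "sel b \<subseteq> S b \<and> card (sel b) = r"
    unfolding sel_def by (intro someI conjI)
  then show "sel b \<subseteq> S b" "card (sel b) = r" by simp_all
qed

lemma alpha_pos: "0 < \<alpha>"
  using msr_codeD(2)[OF msr[OF m_pos]] .

lemma same_block: "b < m \<Longrightarrow> b' < m \<Longrightarrow> i \<in> S b \<Longrightarrow> i \<in> S b' \<Longrightarrow> b = b'"
  using disj by (auto simp: disjoint_family_on_def)

lemma card_subset_I:
  assumes "Z \<subseteq> I"
  shows "card Z = (\<Sum>b<m. card (Z \<inter> S b))"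
proof -
  have "Z = (\<Union>b<m. Z \<inter> S b)" using assms by (auto simp: I_def)
  also have "card \<dots> = (\<Sum>b<m. card (Z \<inter> S b))"
  proof (rule card_UN_disjoint)
    show "\<forall>b\<in>{..<m}. finite (Z \<inter> S b)" using finite_S by simp
    show "\<forall>b\<in>{..<m}. \<forall>b'\<in>{..<m}. b \<noteq> b' \<longrightarrow> (Z \<inter> S b) \<inter> (Z \<inter> S b') = {}"
      using disj unfolding disjoint_family_on_def by blast
  qed simp
  finally show ?thesis .
qed

lemma finite_V: "finite V"
  using finite_I by (intro finite_subset_coord_space[of "I \<times> {1..\<alpha>}"]) (auto simp: V_def)

lemma subspace_V: "fs.subspace V"
proof (rule fs.subspaceI)
  note sub = msr_codeD(4)[OF msr]
  show "0 \<in> V"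
    using sub by (auto simp: V_def restrict_word_linear fs.subspace_0 subspace_coord_space)
  fix x y assume "x \<in> V" "y \<in> V"
  then show "x + y \<in> V"
    using sub
    by (auto simp: V_def restrict_word_linear intro!: fs.subspace_add subspace_coord_space)
next
  fix a x assume "x \<in> V"
  then show "fscale a x \<in> V"
    using msr_codeD(4)[OF msr]
    by (auto simp: V_def restrict_word_linear intro!: fs.subspace_scale subspace_coord_space)
qed

text \<open>The sum of the local words works: each is supported on its own block, and the blocks are
  disjoint.\<close>

lemma glue:
  assumes e: "\<And>b. b < m \<Longrightarrow> e b \<in> E b"
  obtains f where "f \<in> V" "\<And>b. b < m \<Longrightarrow> restrict_word (S b) f = e b"
proof
  let ?f = "(\<lambda>p. \<Sum>b<m. e b p)"
  have eb: "e b \<in> coord_space (S b \<times> {1..\<alpha>})" if "b < m" for b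
    using e[OF that] msr_codeD(3)[OF msr[OF that]] by blast
  show res: "restrict_word (S b) ?f = e b" if b: "b < m" for b
  proof
    fix p :: "nat \<times> nat"
    show "restrict_word (S b) ?f p = e b p"
    proof (cases "fst p \<in> S b")
      case True
      have "e b' p = (if b' = b then e b p else 0)" if b': "b' \<in> {..<m}" for b'
      proof (cases "b' = b")
        case False
        have "fst p \<notin> S b'"
          using same_block[OF b _ True, of b'] b' False by blast
        then show ?thesis
          using coord_space_outside[OF eb] b' False by simp
      qed simp
      then have "?f p = (\<Sum>b'<m. if b' = b then e b p else 0)"
        by (rule sum.cong[OF refl])
      also have "\<dots> = e b p" using b by simp
      finally show ?thesis using True by (simp only: restrict_word_apply if_True)
    next
      case False
      then show ?thesis
        using coord_space_outside[OF eb[OF b] False] by (simp add: restrict_word_apply)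
    qed
  qed
  have "?f \<in> coord_space (I \<times> {1..\<alpha>})"
  proof -
    have "e b p = 0" if "p \<notin> I \<times> {1..\<alpha>}" "b < m" for p b
    proof -
      have "p \<notin> S b \<times> {1..\<alpha>}" using that(1) S_subset_I[OF that(2)] by blast
      then show ?thesis
        by (rule eb[OF that(2), unfolded coord_space_def mem_Collect_eq, rule_format])
    qed
    then show ?thesis unfolding coord_space_def by (auto intro: sum.neutral)
  qed
  moreover have "\<forall>b<m. restrict_word (S b) ?f \<in> E b"
  proof (intro allI impI)
    fix b assume b: "b < m"
    show "restrict_word (S b) ?f \<in> E b"
      unfolding res[OF b] by (rule e[OF b])
  qed
  ultimately show "?f \<in> V"
    unfolding V_def by blast
qed

text \<open>In each block the part of \<open>T\<close> extends to an information set of size r, so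
  some local codeword agrees with \<open>g\<close> on that part. The chosen local codewords are then
  glued.\<close>

lemma V_surj:
  assumes T: "admissible l T" and g: "g \<in> coord_space (T \<times> {1..\<alpha>})"
  shows "g \<in> restrict_word T ` V"
proof -
  have ex: "\<exists>e. e \<in> E b \<and> (\<forall>p. fst p \<in> T \<inter> S b \<longrightarrow> e p = g p)" if b: "b < m" for b
  proof -
    obtain R where R: "T \<inter> S b \<subseteq> R" "R \<subseteq> S b" "card R = r"
      using exists_subset_between[of "T \<inter> S b" r "S b"] T b r_le_card finite_S
      by (auto simp: admissible_def)
    have "restrict_word (T \<inter> S b) g \<in> coord_space ((T \<inter> S b) \<times> {1..\<alpha>})"
      using restrict_word_coord_space[OF g, of "T \<inter> S b"] by (simp add: Int_ac)
    from information_set_surj[OF msr_code_information_set[OF msr[OF b] R(2,3)] R(1) this]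
    obtain e where e: "e \<in> E b" "restrict_word R e = restrict_word (T \<inter> S b) g" .
    have "e p = g p" if "fst p \<in> T \<inter> S b" for p
      using fun_cong[OF e(2), of p] that R by (auto simp: restrict_word_apply)
    then show ?thesis using e by blast
  qed
  define e where "e b = (SOME e. e \<in> E b \<and> (\<forall>p. fst p \<in> T \<inter> S b \<longrightarrow> e p = g p))" for b
  have e: "e b \<in> E b" "fst p \<in> T \<inter> S b \<Longrightarrow> e b p = g p" if "b < m" for b p
    using someI_ex[OF ex[OF that], folded e_def] by blast+
  obtain f where f: "f \<in> V" "\<And>b. b < m \<Longrightarrow> restrict_word (S b) f = e b"
    by (rule glue[of e]) (rule e(1), assumption, rule that)
  have "g p = restrict_word T f p" for p
  proof (cases "fst p \<in> T")
    case True
    then obtain b where "b < m" "fst p \<in> S b"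
      using T by (auto simp: admissible_def I_def)
    then show ?thesis
      using fun_cong[OF f(2), of b p] e(2)[of b p] True by (simp add: restrict_word_apply)
  next
    case False
    then show ?thesis
      using coord_space_outside[OF g False] by (simp add: restrict_word_apply)
  qed
  then show ?thesis using f by (auto simp: image_iff fun_eq_iff)
qed

text \<open>Any set between \<open>R\<close> and the union of the \<open>X b\<close> meets block b
  inside \<open>X b\<close>, hence in at most r symbols; only its size remains to be
  arranged.\<close>

lemma admissible_exists:
  assumes X: "\<And>b. b < m \<Longrightarrow> X b \<subseteq> S b \<and> card (X b) \<le> r"
    and R: "R \<subseteq> (\<Union>b<m. X b)" "card R \<le> l" and l: "l \<le> (\<Sum>b<m. card (X b))"
  obtains T where "R \<subseteq> T" "T \<subseteq> (\<Union>b<m. X b)" "admissible l T"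
proof -
  let ?U = "\<Union>b<m. X b"
  have U: "?U \<subseteq> I" using X by (force simp: I_def)
  have int: "?U \<inter> S b = X b" if "b < m" for b
    using X that same_block by blast
  have "card ?U = (\<Sum>b<m. card (X b))"
    using card_subset_I[OF U] int by simp
  then obtain T where T: "R \<subseteq> T" "T \<subseteq> ?U" "card T = l"
    using exists_subset_between[of R l ?U] R l finite_subset[OF U finite_I] by auto
  have "card (T \<inter> S b) \<le> r" if b: "b < m" for b
  proof -
    have "card (T \<inter> S b) \<le> card (X b)"
    proof (rule card_mono)
      show "finite (X b)"
        using X[OF b] finite_S[OF b] by (auto intro: finite_subset)
      show "T \<inter> S b \<subseteq> X b"
        unfolding int[OF b, symmetric] using T(2) by (rule Int_mono[OF _ subset_refl])
    qed
    then show ?thesis using X[OF b] by simp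
  qed
  then show thesis
    using that T U by (auto simp: admissible_def)
qed

lemma admissible_superset:
  assumes b: "b < m" and R: "R \<subseteq> S b" "card R = r" and l: "r \<le> l" "l \<le> m * r"
  obtains T where "R \<subseteq> T" "admissible l T"
proof -
  \<comment> \<open>Every block now contributes exactly r symbols, \<open>m * r\<close> in total,
    which leaves room for any size l from r to \<open>m * r\<close> around \<open>R\<close>.\<close>
  let ?X = "sel(b := R)"
  have X: "?X b' \<subseteq> S b' \<and> card (?X b') = r" if "b' < m" for b'
    using sel[OF that] R by simp
  have "(\<Sum>b<m. card (?X b)) = (\<Sum>b<m. r)"
    using X by (intro sum.cong) auto
  then have "(\<Sum>b<m. card (?X b)) = m * r" by simp
  moreover have "R \<subseteq> (\<Union>b<m. ?X b)" using b by force
  ultimately show thesis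
    using admissible_exists[of ?X R l] X R l that by force
qed

lemma exists_block_subset:
  assumes "i \<in> I"
  obtains b R where "b < m" "i \<in> R" "R \<subseteq> S b" "card R = r"
proof -
  obtain b where b: "b < m" "i \<in> S b" using assms by (auto simp: I_def)
  have "\<exists>R. {i} \<subseteq> R \<and> R \<subseteq> S b \<and> card R = r"
    using b r_pos r_le_card finite_S by (intro exists_subset_between) auto
  then show thesis using that b by blast
qed

lemma code_exists:
  assumes l: "r \<le> l" "l \<le> m * r" and q: "card I choose l < CARD('a)"
  obtains C where "fs.subspace C" "C \<subseteq> V" "card C = CARD('a) ^ (l * \<alpha>)"
    "\<And>T. admissible l T \<Longrightarrow> information_set \<alpha> C T"
proof -
  let ?N = "\<lambda>T. {f\<in>V. restrict_word T f = 0}"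
  let ?A = "{T. admissible l T}"
  have A: "?A \<subseteq> {T. T \<subseteq> I \<and> card T = l}" by (auto simp: admissible_def)
  have finA: "finite ?A"
    using A by (rule finite_subset) (simp add: finite_I)
  have "card ?A \<le> card I choose l"
    unfolding n_subsets[OF finite_I, symmetric]
    by (rule card_mono[OF _ A]) (simp add: finite_I)
  then have cA: "card (?N ` ?A) < CARD('a)"
    using card_image_le[OF finA, of ?N] q by linarith
  obtain T where "admissible l T"
    using admissible_superset[OF m_pos sel[OF m_pos] l] .
  then have neA: "?A \<noteq> {}" by blast
  have "\<exists>C. fs.subspace C \<and> C \<subseteq> V \<and> card C = CARD('a) ^ (l * \<alpha>) \<and> (\<forall>W\<in>?N ` ?A. C \<inter> W = {0})"
  proof (rule common_complement[OF subspace_V finite_V _ _ cA])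
    fix W assume "W \<in> ?N ` ?A"
    then obtain T where T: "admissible l T" "W = ?N T" by blast
    \<comment> \<open>Free prescription on \<open>T\<close> gives every kernel the same codimension
      \<open>l * \<alpha>\<close>, the form required by \<open>common_complement\<close>.\<close>
    have "restrict_word T ` V = coord_space (T \<times> {1..\<alpha>})"
    proof
      show "restrict_word T ` V \<subseteq> coord_space (T \<times> {1..\<alpha>})"
        by (auto simp: V_def restrict_word_apply coord_space_def)
      show "coord_space (T \<times> {1..\<alpha>}) \<subseteq> restrict_word T ` V"
        using V_surj[OF T(1)] by blast
    qed
    moreover have "finite T" "card T = l"
      using T finite_I finite_subset by (auto simp: admissible_def)
    ultimately have "card V = card W * CARD('a) ^ (l * \<alpha>)"
      using card_kernel_restrict_word[OF subspace_V finite_V, of T] T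
        card_coord_space[of "T \<times> {1..\<alpha>}", where 'a='a]
      by (simp add: card_cartesian_product)
    moreover have "fs.subspace W"
      unfolding T(2)
      by (rule fs.subspaceI)
         (auto simp: restrict_word_linear fs.subspace_0 fs.subspace_add fs.subspace_scale subspace_V)
    ultimately show "fs.subspace W \<and> W \<subseteq> V \<and> card V = card W * CARD('a) ^ (l * \<alpha>)"
      using T by blast
  qed (use finA neA in auto)
  then obtain C where C: "fs.subspace C" "C \<subseteq> V" "card C = CARD('a) ^ (l * \<alpha>)"
    "\<forall>W\<in>?N ` ?A. C \<inter> W = {0}" by (elim exE conjE) (rule that)
  have "information_set \<alpha> C T" if T: "admissible l T" for T
  proof (rule information_setI)
    show "C \<subseteq> coord_space (I \<times> {1..\<alpha>})" using C by (auto simp: V_def)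
    show "T \<subseteq> I" using T by (simp add: admissible_def)
    then show "finite T" by (rule finite_subset[OF _ finite_I])
    show "card C = CARD('a) ^ (card T * \<alpha>)" using C T by (simp add: admissible_def)
    \<comment> \<open>Two codewords that agree on \<open>T\<close> differ by an element of the
      kernel, which meets \<open>C\<close> only in 0.\<close>
    show "inj_on (restrict_word T) C"
    proof (rule inj_onI)
      fix x y assume xy: "x \<in> C" "y \<in> C" "restrict_word T x = restrict_word T y"
      then have "x - y \<in> C" "restrict_word T (x - y) = 0"
        using C(1) by (simp_all add: restrict_word_linear fs.subspace_diff)
      moreover have "C \<inter> ?N T = {0}"
        using T by (intro C(4)[THEN bspec] imageI) simp
      ultimately have "x - y = 0" using C(2) by blast
      then show "x = y" by simp
    qed
  qed
  with C(1-3) show thesis by (rule that)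
qed

section \<open>Locality and minimum distance of the constructed code\<close>

context
  fixes C :: "'a word set" and l :: nat
  assumes sub: "fs.subspace C" and C_V: "C \<subseteq> V" and card_C: "card C = CARD('a) ^ (l * \<alpha>)"
    and info: "\<And>T. admissible l T \<Longrightarrow> information_set \<alpha> C T"
    and l: "r \<le> l" "l \<le> m * r"
begin

lemma C_coord: "C \<subseteq> coord_space (I \<times> {1..\<alpha>})"
  using C_V by (auto simp: V_def)

lemma C_block: "c \<in> C \<Longrightarrow> b < m \<Longrightarrow> restrict_word (S b) c \<in> E b"
  using C_V unfolding V_def by blast

lemma vector_code: "vector_code I (l * \<alpha>) \<alpha> C"
proof (rule vector_codeI[OF finite_I alpha_pos C_coord sub card_C])
  fix i assume "i \<in> I"
  then obtain b R where R: "b < m" "i \<in> R" "R \<subseteq> S b" "card R = r" by (rule exists_block_subset)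
  obtain T where "R \<subseteq> T" "admissible l T"
    using admissible_superset[OF R(1,3,4) l] .
  then show "\<exists>T. i \<in> T \<and> information_set \<alpha> C T"
    using R(2) info[of T] by auto
qed

text \<open>As r \<le> l, an information set \<open>R\<close> of the block extends to an admissible
  set. Some codeword agrees with a given local word on \<open>R\<close>; its restriction to the
  block is again a local codeword, so the two coincide.\<close>

lemma punctured_block:
  assumes b: "b < m"
  shows "punctured C (S b) = E b"
proof
  show "punctured C (S b) \<subseteq> E b"
    using C_block[OF _ b] by (auto simp: punctured_def)
  show "E b \<subseteq> punctured C (S b)"
  proof
    fix e assume e: "e \<in> E b"
    define R where "R = sel b"
    note R = sel[OF b, folded R_def]
    obtain T where T: "R \<subseteq> T" "admissible l T"
      using admissible_superset[OF b R l] .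
    have "e \<in> coord_space (S b \<times> {1..\<alpha>})"
      using e msr_codeD(3)[OF msr[OF b]] by blast
    then have "restrict_word R e \<in> coord_space (R \<times> {1..\<alpha>})"
      by (auto simp: restrict_word_apply coord_space_def)
    from information_set_surj[OF info[OF T(2)] T(1) this]
    obtain c where c: "c \<in> C" "restrict_word T c = restrict_word R e" .
    have "restrict_word R (restrict_word (S b) c) = restrict_word R (restrict_word T c)"
      using R T by (simp add: restrict_word_restrict_word Int_absorb2)
    also have "\<dots> = restrict_word R e"
      using c by (simp add: restrict_word_restrict_word)
    finally have "restrict_word (S b) c = e"
      by (rule information_set_inj[OF msr_code_information_set[OF msr[OF b] R]
            C_block[OF c(1) b] e])
    then show "e \<in> punctured C (S b)" using c by (auto simp: punctured_def)
  qed
qed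

lemma thick_rank_eq:
  assumes "generator_matrix (l * \<alpha>) C G"
  shows "thick_rank (l * \<alpha>) \<alpha> G I = l * \<alpha>"
proof -
  obtain T where T: "admissible l T"
    using admissible_superset[OF m_pos sel[OF m_pos] l] .
  then have "T \<subseteq> I" "card T = l" by (auto simp: admissible_def)
  then show ?thesis
    using thick_rank_information_set[OF assms info[OF T]] finite_I finite_subset by auto
qed

text \<open>The zeros are cut down to at most r per block. What is left has at most l - 1 elements,
  and what was cut away is at most \<open>N - r\<close> in each block with more than r
  zeros.\<close>

lemma zeros_bound:
  assumes c: "c \<in> C" "c \<noteq> 0" and N: "\<And>b. b < m \<Longrightarrow> card (S b) = N"
  shows "card {i\<in>I. symb c i = 0} \<le> (l - 1) + ((l - 1) div r) * (N - r)"
proof -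
  let ?Z = "{i\<in>I. symb c i = 0}"
  let ?z = "\<lambda>b. card (?Z \<inter> S b)"
  have "\<exists>Y. Y \<subseteq> ?Z \<inter> S b \<and> card Y = min (?z b) r" for b
  proof -
    obtain Y where "Y \<subseteq> ?Z \<inter> S b" "card Y = min (?z b) r"
      using obtain_subset_with_card_n[OF min.cobounded1] .
    then show ?thesis by (intro exI conjI)
  qed
  from choice[OF allI[OF this]]
  obtain X where "\<forall>b. X b \<subseteq> ?Z \<inter> S b \<and> card (X b) = min (?z b) r" ..
  then have X: "X b \<subseteq> ?Z \<inter> S b" "card (X b) = min (?z b) r" for b by simp_all
  \<comment> \<open>Otherwise the truncated zero set would contain an admissible set, which is an
    information set on which \<open>c\<close> vanishes.\<close>
  have le: "(\<Sum>b<m. min (?z b) r) \<le> l - 1"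
  proof (rule ccontr)
    assume "\<not> ?thesis"
    then have "l \<le> (\<Sum>b<m. card (X b))" using X by simp
    then obtain T where T: "T \<subseteq> (\<Union>b<m. X b)" "admissible l T"
      using admissible_exists[of X "{}" l] X by auto
    have "T \<subseteq> ?Z" using T(1) X(1) by blast
    then have "restrict_word T c = restrict_word T 0"
      by (auto simp: restrict_word_eq_0_iff restrict_word_linear)
    from information_set_inj[OF info[OF T(2)] c(1) fs.subspace_0[OF sub] this]
    show False using c(2) by contradiction
  qed
  \<comment> \<open>Each block with more than r zeros contributes r to the truncated sum, so there
    are at most (l - 1) div r of them.\<close>
  define t where "t = card {b\<in>{..<m}. r < ?z b}"
  have ind: "(\<Sum>b<m. if r < ?z b then k else 0) = t * k" for k :: nat
    by (simp add: t_def sum.If_cases Int_def)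
  have "t * r \<le> (\<Sum>b<m. min (?z b) r)"
    unfolding ind[symmetric] by (rule sum_mono) auto
  then have "t * r \<le> l - 1" using le by simp
  then have t: "t \<le> (l - 1) div r"
    using r_pos by (simp add: less_eq_div_iff_mult_less_eq)
  have zN: "?z b \<le> N" if "b < m" for b
    using card_mono[OF finite_S[OF that], of "?Z \<inter> S b"] N[OF that] by simp
  have "card ?Z = (\<Sum>b<m. ?z b)"
    by (rule card_subset_I) auto
  also have "\<dots> \<le> (\<Sum>b<m. min (?z b) r + (if r < ?z b then N - r else 0))"
  proof (rule sum_mono)
    fix b assume "b \<in> {..<m}"
    then have "?z b \<le> N" using zN by simp
    moreover have "z \<le> N \<Longrightarrow> z \<le> min z r + (if r < z then N - r else 0)" for z :: nat
      by arith
    ultimately show "?z b \<le> min (?z b) r + (if r < ?z b then N - r else 0)" by blast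
  qed
  also have "\<dots> = (\<Sum>b<m. min (?z b) r) + t * (N - r)"
    by (simp only: sum.distrib ind)
  also have "\<dots> \<le> (l - 1) + ((l - 1) div r) * (N - r)"
    using le t by (intro add_mono mult_right_mono) auto
  finally show ?thesis .
qed

text \<open>\<open>l - 1\<close> symbols never determine a codeword. Spending them on \<open>r\<close> symbols in each of
  \<open>(l - 1) div r\<close> local codes forces all the symbols of those local codes to vanish.\<close>

lemma low_weight_word:
  assumes N: "\<And>b. b < m \<Longrightarrow> card (S b) = N"
  obtains c where "c \<in> C" "c \<noteq> 0"
    "(l - 1) + ((l - 1) div r) * (N - r) \<le> card {i\<in>I. symb c i = 0}"
proof -
  \<comment> \<open>Blocks 0 to a - 1 receive r symbols each and block \<open>a\<close> receives the
    remaining \<open>e\<close>.\<close>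
  define a where "a = (l - 1) div r"
  define e where "e = (l - 1) mod r"
  have l_eq: "l - 1 = a * r + e" by (simp add: a_def e_def)
  have e: "e < r" using r_pos by (simp add: e_def)
  \<comment> \<open>This guarantees that block \<open>a\<close> exists and can host the
    remainder.\<close>
  have "l - 1 < m * r" using l r_pos by linarith
  then have a: "a < m" using r_pos by (simp add: a_def div_less_iff_less_mult)
  have "e \<le> card (S a)" using e r_le_card[OF a] by simp
  then obtain Q where Q: "Q \<subseteq> S a" "card Q = e"
    by (rule obtain_subset_with_card_n) (rule that)
  have finQ: "finite Q" by (rule finite_subset[OF Q(1) finite_S[OF a]])
  have finY: "finite (sel b)" if "b < m" for b
    by (rule finite_subset[OF sel(1)[OF that] finite_S[OF that]])
  let ?P = "(\<Union>b<a. sel b) \<union> Q"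
  have finP: "finite ?P" using finQ finY a by auto
  have "card (\<Union>b<a. sel b) \<le> (\<Sum>b<a. card (sel b))" by (rule card_UN_le) simp
  also have "\<dots> = (\<Sum>b<a. r)" using sel a by (intro sum.cong) auto
  finally have "card ?P \<le> l - 1"
    using card_Un_le[of "\<Union>b<a. sel b" Q] Q l_eq by simp
  \<comment> \<open>Fewer than \<open>l * \<alpha>\<close> scalars are visible on \<open>?P\<close>,
    so two distinct codewords agree there; their difference is the word sought.\<close>
  then have "card ?P * \<alpha> < l * \<alpha>"
    using l r_pos alpha_pos by (intro mult_strict_right_mono) auto
  then have "CARD('a) ^ (card ?P * \<alpha>) < card C"
    unfolding card_C using card_field_ge_2[where 'a='a] by (intro power_strict_increasing) auto
  moreover have X: "finite (coord_space (?P \<times> {1..\<alpha>}) :: 'a word set)"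
    "card (coord_space (?P \<times> {1..\<alpha>}) :: 'a word set) = CARD('a) ^ (card ?P * \<alpha>)"
    using card_coord_space[of "?P \<times> {1..\<alpha>}", where 'a='a] finP
    by (simp_all add: card_cartesian_product)
  moreover have im: "restrict_word ?P ` C \<subseteq> coord_space (?P \<times> {1..\<alpha>})"
    using C_coord by (fastforce simp: restrict_word_apply coord_space_def)
  ultimately have "\<not> inj_on (restrict_word ?P) C"
    using card_inj_on_le[OF _ im X(1)] by linarith
  then obtain x y where xy: "x \<in> C" "y \<in> C" "x \<noteq> y" "restrict_word ?P x = restrict_word ?P y"
    by (auto simp: inj_on_def)
  let ?c = "x - y"
  have c: "?c \<in> C" "?c \<noteq> 0" using xy sub by (auto simp: fs.subspace_diff)
  have zP: "symb ?c i = 0" if "i \<in> ?P" for i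
  proof -
    have "restrict_word ?P ?c = 0" using xy by (simp add: restrict_word_linear)
    then show ?thesis using that by (simp only: restrict_word_eq_0_iff)
  qed
  have zS: "symb ?c i = 0" if b: "b < a" and i: "i \<in> S b" for b i
  proof -
    have bm: "b < m" using a b by simp
    have E0: "0 \<in> E b" by (rule fs.subspace_0[OF msr_codeD(4)[OF msr[OF bm]]])
    \<comment> \<open>The local part of the difference vanishes on an information set of its block,
      hence on the whole block.\<close>
    have "restrict_word (sel b) (restrict_word (S b) ?c) = restrict_word (sel b) 0"
      using sel[OF bm] zP b
      by (auto simp: restrict_word_restrict_word Int_absorb2 restrict_word_linear(4)
          restrict_word_eq_0_iff simp del: restrict_word_linear(2))
    then have "restrict_word (S b) ?c = 0"
      by (rule information_set_inj[OF msr_code_information_set[OF msr[OF bm] sel[OF bm]]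
            C_block[OF c(1) bm] E0])
    then show ?thesis using i by (simp add: restrict_word_eq_0_iff)
  qed
  let ?U = "(\<Union>b<a. S b) \<union> Q"
  have "card ?U = a * N + e"
  proof -
    have "card (\<Union>b<a. S b) = (\<Sum>b<a. card (S b))"
    proof (rule card_UN_disjoint)
      show "\<forall>b\<in>{..<a}. finite (S b)" using finite_S a by simp
      show "\<forall>b\<in>{..<a}. \<forall>b'\<in>{..<a}. b \<noteq> b' \<longrightarrow> S b \<inter> S b' = {}"
        using disj a by (simp add: disjoint_family_on_def)
    qed simp
    also have "\<dots> = (\<Sum>b<a. N)" using N a by (intro sum.cong) auto
    finally have "card (\<Union>b<a. S b) = a * N" by simp
    moreover have "(\<Union>b<a. S b) \<inter> Q = {}"
    proof (rule equals0I)
      fix i assume "i \<in> (\<Union>b<a. S b) \<inter> Q"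
      then obtain b where "b < a" "i \<in> S b" "i \<in> S a" using Q(1) by blast
      then show False using same_block[of b a i] a by simp
    qed
    ultimately show ?thesis
      using Q finQ finite_S a by (subst card_Un_disjoint) auto
  qed
  moreover have "?U \<subseteq> {i\<in>I. symb ?c i = 0}"
  proof
    fix i assume "i \<in> ?U"
    then consider b where "b < a" "i \<in> S b" | "i \<in> Q" by blast
    then show "i \<in> {i\<in>I. symb ?c i = 0}"
    proof cases
      case 1
      then show ?thesis using zS[OF 1] S_subset_I[of b] a by auto
    next
      case 2
      then have "symb ?c i = 0" by (intro zP) blast
      then show ?thesis using 2 Q(1) S_subset_I[OF a] by blast
    qed
  qed
  then have "card ?U \<le> card {i\<in>I. symb ?c i = 0}"
    by (rule card_mono[rotated]) (simp add: finite_I)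
  moreover have "a * N + e = (l - 1) + a * (N - r)"
  proof -
    have "N = r + (N - r)" using r_le_card[OF a] N[OF a] by simp
    then have "a * N = a * r + a * (N - r)" by (simp flip: distrib_left)
    then show ?thesis using l_eq by linarith
  qed
  ultimately show thesis
    using that[OF c] unfolding a_def by linarith
qed

text \<open>\<open>zeros_bound\<close> and \<open>low_weight_word\<close> give the two inequalities.
  The additive form avoids truncated subtraction; the subtracted amount is at most
  \<open>m * N\<close> because some codeword has that many zeros.\<close>

lemma d_min_eq:
  assumes N: "\<And>b. b < m \<Longrightarrow> card (S b) = N"
  shows "d_min C + ((l - 1) + ((l - 1) div r) * (N - r)) = m * N"
proof -
  let ?t = "(l - 1) + ((l - 1) div r) * (N - r)"
  have cI: "card I = m * N"
    using card_subset_I[OF order_refl] N S_subset_I by (simp add: Int_absorb1)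
  have w: "weight c = m * N - card {i\<in>I. symb c i = 0}" if "c \<in> C" for c
    using weight_eq[of c I "{1..\<alpha>}"] that C_coord finite_I cI by auto
  obtain c where c: "c \<in> C" "c \<noteq> 0" "?t \<le> card {i\<in>I. symb c i = 0}"
    by (rule low_weight_word[OF N]) (assumption, rule that)
  have "card {i\<in>I. symb c i = 0} \<le> m * N"
    unfolding cI[symmetric] by (rule card_mono[OF finite_I]) auto
  then have "?t \<le> m * N" using c by simp
  moreover have "d_min C \<le> m * N - ?t"
    using d_min_le[OF c(1,2)] w[OF c(1)] c(3) by linarith
  moreover have "m * N - ?t \<le> d_min C"
    using w zeros_bound[OF _ _ N] c by (intro le_d_minI) (auto intro!: diff_le_mono2)
  ultimately show ?thesis by linarith
qed

lemma msr_local: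
  assumes N: "\<And>b. b < m \<Longrightarrow> card (S b) = r + \<delta> - 1"
  shows "msr_local_all_symbol I (l * \<alpha>) \<alpha> r \<delta> d C"
proof -
  obtain G where G: "generator_matrix (l * \<alpha>) C G"
    using vector_code by (auto simp: vector_code_def)
  \<comment> \<open>Blocks are numbered from 0 here, but from 1 in
    \<open>msr_local_all_symbol\<close>.\<close>
  let ?S = "\<lambda>i. S (i - 1)"
  have img: "{..<m} = (\<lambda>i. i - 1) ` {1..m}"
  proof
    show "{..<m} \<subseteq> (\<lambda>i. i - 1) ` {1..m}"
    proof
      fix b assume "b \<in> {..<m}"
      then have "b = Suc b - 1" "Suc b \<in> {1..m}" by auto
      then show "b \<in> (\<lambda>i. i - 1) ` {1..m}" by blast
    qed
  qed auto
  have U: "(\<Union>i\<in>{1..m}. ?S i) = I"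
    unfolding I_def img by simp
  have loc: "?S i \<subseteq> I \<and> card (?S i) = r + \<delta> - 1 \<and> msr_code (?S i) r d \<alpha> \<beta> (punctured C (?S i))"
    if "i \<in> {1..m}" for i
  proof -
    have "i - 1 < m" using that by auto
    then show ?thesis
      using S_subset_I N msr punctured_block by simp
  qed
  \<comment> \<open>For blocks of size r + \<delta> - 1 the bound \<open>card I + 1 - r\<close>
    equals \<delta>.\<close>
  have "\<delta> \<le> d_min (punctured C (?S i))" if i: "i \<in> {1..m}" for i
    using d_min_msr_code_ge[of "?S i" r d \<alpha> \<beta> "punctured C (?S i)"] loc[OF i] r_pos by simp
  then have "information_locality I (l * \<alpha>) \<alpha> r \<delta> C"
    unfolding information_locality_def
    using G U thick_rank_eq[OF G] loc
    by (intro exI[of _ G] conjI exI[of _ "{1..m}"] exI[of _ ?S]) auto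
  moreover have "\<forall>i\<in>{1..m}. ?S i \<subseteq> I \<and> card (?S i) = r + \<delta> - 1 \<and>
      (\<exists>\<beta>. msr_code (?S i) r d \<alpha> \<beta> (punctured C (?S i)))"
    using loc by blast
  ultimately show ?thesis
    unfolding msr_local_all_symbol_def
  proof (intro conjI exI[of _ G] exI[of _ m] exI[of _ ?S])
    show "thick_rank (l * \<alpha>) \<alpha> G (\<Union>i\<in>{1..m}. ?S i) = l * \<alpha>"
      unfolding U by (rule thick_rank_eq[OF G])
  qed (rule vector_code G U | assumption)+
qed

end

lemma msr_local_code_exists:
  assumes N: "\<And>b. b < m \<Longrightarrow> card (S b) = r + \<delta> - 1"
    and l: "r \<le> l" "l \<le> m * r" and q: "card (\<Union>b<m. S b) choose l < CARD('a)"
  obtains C :: "'a word set" where "vector_code (\<Union>b<m. S b) (l * \<alpha>) \<alpha> C"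
    "msr_local_all_symbol (\<Union>b<m. S b) (l * \<alpha>) \<alpha> r \<delta> d C"
    "d_min C + ((l - 1) + ((l - 1) div r) * (\<delta> - 1)) = m * (r + \<delta> - 1)"
proof -
  obtain C where C: "fs.subspace C" "C \<subseteq> V" "card C = CARD('a) ^ (l * \<alpha>)"
    "\<And>T. admissible l T \<Longrightarrow> information_set \<alpha> C T"
    by (rule code_exists[OF l q[folded I_def]]) (rule that)
  show thesis
  proof (rule that)
    show "vector_code (\<Union>b<m. S b) (l * \<alpha>) \<alpha> C"
      by (rule vector_code[OF C l, unfolded I_def])
    show "msr_local_all_symbol (\<Union>b<m. S b) (l * \<alpha>) \<alpha> r \<delta> d C"
      by (rule msr_local[OF C l N, unfolded I_def])
    have "r + \<delta> - 1 - r = \<delta> - 1" by simp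
    then show "d_min C + ((l - 1) + ((l - 1) div r) * (\<delta> - 1)) = m * (r + \<delta> - 1)"
      using d_min_eq[OF C l N] by simp
  qed
qed

end

section \<open>Blocks of consecutive labels and the closed form of the distance\<close>

theorem mainTheorem11:
  fixes r \<delta> n\<^sub>L d \<alpha> \<beta> l m n K :: nat
  assumes "1 \<le> r" and "3 \<le> \<delta>" and "n\<^sub>L = r + \<delta> - 1"
    and "\<exists>C\<^sub>0 :: 'a::{field,finite} word set. msr_code {1..n\<^sub>L} r d \<alpha> \<beta> C\<^sub>0"
    and "K = l * \<alpha>" and "0 < l" and "r \<le> l"
    and "n = m * n\<^sub>L" and "0 < m" and "real l / real r \<le> real m"
    and "n choose l < CARD('a)"
  shows "\<exists>C :: 'a word set.
           vector_code {1..n} K \<alpha> C \<and>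
           msr_local_all_symbol {1..n} K \<alpha> r \<delta> d C \<and>
           real (d_min C) =
             real n - real K / real \<alpha> + 1
               - (of_int \<lceil>real K / (real r * real \<alpha>)\<rceil> - 1) * (real \<delta> - 1)"
proof -
  obtain C\<^sub>0 :: "'a word set" where C0: "msr_code {1..n\<^sub>L} r d \<alpha> \<beta> C\<^sub>0"
    using assms(4) by blast
  define S where "S b = {b * n\<^sub>L + 1..b * n\<^sub>L + n\<^sub>L}" for b
  define E where "E b = relabel (\<lambda>i. i - b * n\<^sub>L) ` C\<^sub>0" for b
  have nL: "0 < n\<^sub>L" using assms(1-3) by simp
  \<comment> \<open>Labels start at 1, so the block of i is the quotient of i - 1; disjointness and
    covering both follow from this.\<close>
  have mem_S: "i \<in> S b \<longleftrightarrow> 0 < i \<and> (i - 1) div n\<^sub>L = b" for i b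
  proof -
    have "b * n\<^sub>L \<le> k \<and> k < b * n\<^sub>L + n\<^sub>L \<longleftrightarrow> k div n\<^sub>L = b" for k
    proof
      assume "b * n\<^sub>L \<le> k \<and> k < b * n\<^sub>L + n\<^sub>L"
      then show "k div n\<^sub>L = b" by (intro div_nat_eqI) (simp_all add: mult.commute)
    next
      assume "k div n\<^sub>L = b"
      then show "b * n\<^sub>L \<le> k \<and> k < b * n\<^sub>L + n\<^sub>L"
        using dividend_less_div_times[OF nL, of k] div_times_less_eq_dividend[of k n\<^sub>L]
        by (simp only: add.commute)
    qed
    from this[of "i - 1"] show ?thesis
      by (cases i) (auto simp: S_def)
  qed
  have card_S: "card (S b) = n\<^sub>L" for b by (simp add: S_def)
  have codes: "local_codes S E r d \<alpha> \<beta> m"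
  proof
    show "msr_code (S b) r d \<alpha> \<beta> (E b)" for b
      unfolding E_def
    proof (rule msr_code_relabel[OF C0])
      show "bij_betw (\<lambda>i. i - b * n\<^sub>L) (S b) {1..n\<^sub>L}"
        by (rule bij_betwI[where g = "\<lambda>i. i + b * n\<^sub>L"]) (auto simp: S_def)
      \<comment> \<open>Truncated subtraction sends the labels before block b to 0, which is not a
        label of \<open>C\<^sub>0\<close>.\<close>
      show "(\<lambda>i. i - b * n\<^sub>L) -` {1..n\<^sub>L} = S b" by (auto simp: S_def)
    qed (use assms(1) in simp)
    show "disjoint_family_on S {..<m}"
      by (auto simp: disjoint_family_on_def mem_S)
  qed (use assms(1,9) in simp_all)
  have I: "(\<Union>b<m. S b) = {1..n}"
  proof -
    have "0 < i \<and> (i - 1) div n\<^sub>L < m \<longleftrightarrow> i \<in> {1..n}" for i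
      using nL unfolding assms(8) by (cases i) (simp_all add: div_less_iff_less_mult Suc_le_eq)
    moreover have "i \<in> (\<Union>b<m. S b) \<longleftrightarrow> 0 < i \<and> (i - 1) div n\<^sub>L < m" for i
      by (simp only: UN_iff mem_S lessThan_iff) blast
    ultimately show ?thesis by blast
  qed
  have "real l \<le> real (m * r)"
    using assms(1,10) by (simp add: field_simps)
  then have lm: "l \<le> m * r" by linarith
  have choose: "card (\<Union>b<m. S b) choose l < CARD('a)" using assms(11) by (simp add: I)
  have card_S': "card (S b) = r + \<delta> - 1" for b by (simp add: card_S assms(3))
  obtain C :: "'a word set" where C: "vector_code {1..n} (l * \<alpha>) \<alpha> C"
    "msr_local_all_symbol {1..n} (l * \<alpha>) \<alpha> r \<delta> d C"
    "d_min C + ((l - 1) + ((l - 1) div r) * (\<delta> - 1)) = n"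
    using local_codes.msr_local_code_exists[OF codes card_S' assms(7) lm choose]
    unfolding I assms(3)[symmetric] assms(8)[symmetric] .
  \<comment> \<open>For positive l, the quotient a of l - 1 by r satisfies a r < l \<le> (a + 1) r,
    which pins the ceiling at a + 1 even when r divides l.\<close>
  have "\<lceil>real l / real r\<rceil> = int ((l - 1) div r) + 1"
  proof (rule ceiling_unique)
    define a where "a = (l - 1) div r"
    have "a * r \<le> l - 1" "l - 1 < (a + 1) * r"
      using assms(1) dividend_less_div_times[of r "l - 1"] by (auto simp: a_def)
    then have "a * r < l" "l \<le> Suc a * r" using assms(6) by auto
    then have "real a * real r < real l" "real l \<le> real (Suc a) * real r"
      by (simp_all flip: of_nat_mult of_nat_Suc)
    then show "of_int (int ((l - 1) div r) + 1) - 1 < real l / real r"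
      "real l / real r \<le> of_int (int ((l - 1) div r) + 1)"
      unfolding a_def[symmetric] using assms(1) by (simp_all add: field_simps)
  qed
  moreover have "real K / (real r * real \<alpha>) = real l / real r" "real K / real \<alpha> = real l"
    using msr_codeD(2)[OF C0] assms(5) by auto
  \<comment> \<open>The truncated differences l - 1 and \<delta> - 1 are exact because l is positive
    and \<delta> is at least 3.\<close>
  moreover have "real (d_min C) + ((real l - 1) + real ((l - 1) div r) * (real \<delta> - 1)) = real n"
  proof -
    have "real (d_min C + ((l - 1) + ((l - 1) div r) * (\<delta> - 1))) = real n"
      by (simp only: C(3))
    then show ?thesis using assms(2,6) by (simp add: of_nat_diff)
  qed
  ultimately have "real (d_min C) = real n - real K / real \<alpha> + 1
      - (of_int \<lceil>real K / (real r * real \<alpha>)\<rceil> - 1) * (real \<delta> - 1)"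
    by simp
  then show ?thesis using C(1,2) unfolding assms(5) by blast
qed

end
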